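(* Let $U\subset\mathbb{R}^2$ be open, $\mathbf{x}:U\to\mathbb{R}^3$ a frontal and $\Omega:U\to\mathcal{M}_{3\times2}(\mathbb{R})$ any tangent moving base of $\mathbf{x}$. Then $\mathbf{x}$ is a front if and only if $(K_\Omega,H_\Omega)\neq(0,0)$ at every point of $\Sigma(\mathbf{x})$.
   Context: Smooth means $C^\infty$; $D\mathbf{f}$ is the Jacobian matrix. A smooth map $\mathbf{x}:U\to\mathbb{R}^3$ is a frontal if for every $p\in U$ there are an open neighborhood $V_p\subset U$ of $p$ and a smooth $\nu:V_p\to\mathbb{R}^3$ with $|\nu|=1$ and $\nu\cdot\mathbf{x}_u=\nu\cdot\mathbf{x}_v=0$ on $V_p$. A tangent moving base of $\mathbf{x}$ is a smooth map $\Omega=(\mathbf{w}_1\ \mathbf{w}_2):U\to\mathcal{M}_{3\times2}(\mathbb{R})$ whose columns are linearly independent at every point and such that $\mathbf{x}_u,\mathbf{x}_v\in\mathrm{span}(\mathbf{w}_1,\mathbf{w}_2)$ at every point. Given $\Omega$: $\mathbf{n}=\frac{\mathbf{w}_1\times\mathbf{w}_2}{\|\mathbf{w}_1\times\mathbf{w}_2\|}$ (the unit normal field used for $\mathbf{x}$); $\mathbf{I}_\Omega:=\Omega^T\Omega$; $\mathbf{II}_\Omega:=-\Omega^TD\mathbf{n}$; $\mu:=-\mathbf{II}_\Omega^T\mathbf{I}_\Omega^{-1}$; $\Lambda:=D\mathbf{x}^T\Omega\,\mathbf{I}_\Omega^{-1}$ (so $D\mathbf{x}=\Omega\Lambda^T$).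 The $\Omega$-relative curvature is $K_\Omega:=\det\mu$ and the $\Omega$-relative mean curvature is $H_\Omega:=-\frac12\mathrm{tr}(\mu\,\mathrm{adj}(\Lambda))$, where $\mathrm{adj}$ is the adjugate matrix. $\Sigma(\mathbf{x})$ is the set of points of $U$ where $\mathbf{x}$ is not immersive. The frontal $\mathbf{x}$ is a front if $(\mathbf{x},\mathbf{n}):U\to\mathbb{R}^3\times\mathbb{R}^3$ is an immersion at every point of $U$. *)

theory Defs
  imports "HOL-Analysis.Analysis"
begin

text \<open>Differentiability of class $C^k$ through iterated directional derivatives.  Derivatives are
  taken at interior points, so \<open>S\<close> is meant to be open.\<close>

primrec Ck_on :: "nat \<Rightarrow> 'a set \<Rightarrow> ('a::euclidean_space \<Rightarrow> 'b::euclidean_space) \<Rightarrow> bool" where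
  "Ck_on 0 S f \<longleftrightarrow> continuous_on S f"
| "Ck_on (Suc k) S f \<longleftrightarrow>
     (\<forall>p\<in>S. f differentiable (at p)) \<and>
     (\<forall>v. Ck_on k S (\<lambda>p. frechet_derivative f (at p) v))"

definition smooth_on :: "'a set \<Rightarrow> ('a::euclidean_space \<Rightarrow> 'b::euclidean_space) \<Rightarrow> bool" where
  "smooth_on S f \<longleftrightarrow> (\<forall>k. Ck_on k S f)"

text \<open>For \<open>x :: real^2 \<Rightarrow> real^3\<close>, the matrix \<open>jacobian x (at p) :: real^2^3\<close> has three rows and two
  columns; its columns are the partial derivatives $x_u$ and $x_v$ at \<open>p\<close>.\<close>

definition frontal_on :: "(real^2) set \<Rightarrow> (real^2 \<Rightarrow> real^3) \<Rightarrow> bool" where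
  "frontal_on U x \<longleftrightarrow> smooth_on U x \<and>
     (\<forall>p\<in>U. \<exists>V \<nu>. open V \<and> p \<in> V \<and> V \<subseteq> U \<and> smooth_on V (\<nu> :: real^2 \<Rightarrow> real^3) \<and>
        (\<forall>q\<in>V. norm (\<nu> q) = 1 \<and>
           \<nu> q \<bullet> column 1 (jacobian x (at q)) = 0 \<and>
           \<nu> q \<bullet> column 2 (jacobian x (at q)) = 0))"

text \<open>The inequality of the columns is needed because \<open>independent\<close> is a property of sets.\<close>

definition tangent_moving_base :: "(real^2) set \<Rightarrow> (real^2 \<Rightarrow> real^3) \<Rightarrow> (real^2 \<Rightarrow> real^2^3) \<Rightarrow> bool" where
  "tangent_moving_base U x \<Omega> \<longleftrightarrow> smooth_on U \<Omega> \<and>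
     (\<forall>p\<in>U. let w1 = column 1 (\<Omega> p); w2 = column 2 (\<Omega> p) in
        w1 \<noteq> w2 \<and> independent {w1, w2} \<and>
        column 1 (jacobian x (at p)) \<in> span {w1, w2} \<and>
        column 2 (jacobian x (at p)) \<in> span {w1, w2})"

definition unit_normal :: "(real^2 \<Rightarrow> real^2^3) \<Rightarrow> real^2 \<Rightarrow> real^3" where
  "unit_normal \<Omega> p =
     cross3 (column 1 (\<Omega> p)) (column 2 (\<Omega> p)) /\<^sub>R
     norm (cross3 (column 1 (\<Omega> p)) (column 2 (\<Omega> p)))"

definition fund_I :: "(real^2 \<Rightarrow> real^2^3) \<Rightarrow> real^2 \<Rightarrow> real^2^2" where
  "fund_I \<Omega> p = transpose (\<Omega> p) ** \<Omega> p"

definition fund_II :: "(real^2 \<Rightarrow> real^2^3) \<Rightarrow> real^2 \<Rightarrow> real^2^2" where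
  "fund_II \<Omega> p = - (transpose (\<Omega> p) ** jacobian (unit_normal \<Omega>) (at p))"

definition mu_mat :: "(real^2 \<Rightarrow> real^2^3) \<Rightarrow> real^2 \<Rightarrow> real^2^2" where
  "mu_mat \<Omega> p = - (transpose (fund_II \<Omega> p) ** matrix_inv (fund_I \<Omega> p))"

definition Lambda_mat :: "(real^2 \<Rightarrow> real^3) \<Rightarrow> (real^2 \<Rightarrow> real^2^3) \<Rightarrow> real^2 \<Rightarrow> real^2^2" where
  "Lambda_mat x \<Omega> p = transpose (jacobian x (at p)) ** \<Omega> p ** matrix_inv (fund_I \<Omega> p)"

definition adjugate2 :: "real^2^2 \<Rightarrow> real^2^2" where
  "adjugate2 A = vector [vector [A$2$2, - A$1$2], vector [- A$2$1, A$1$1]]"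

lemma adjugate2_mult:
  "A ** adjugate2 A = mat (det A)" "adjugate2 A ** A = mat (det A)"
  by (simp_all add: adjugate2_def matrix_matrix_mult_def mat_def vec_eq_iff forall_2 sum_2 det_2)

definition relative_curvature :: "(real^2 \<Rightarrow> real^2^3) \<Rightarrow> real^2 \<Rightarrow> real" where
  "relative_curvature \<Omega> p = det (mu_mat \<Omega> p)"

definition relative_mean_curvature ::
    "(real^2 \<Rightarrow> real^3) \<Rightarrow> (real^2 \<Rightarrow> real^2^3) \<Rightarrow> real^2 \<Rightarrow> real" where
  "relative_mean_curvature x \<Omega> p =
     - (1/2) * trace (mu_mat \<Omega> p ** adjugate2 (Lambda_mat x \<Omega> p))"

definition immersive_at :: "('a::euclidean_space \<Rightarrow> 'b::euclidean_space) \<Rightarrow> 'a \<Rightarrow> bool" where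
  "immersive_at f p \<longleftrightarrow> f differentiable (at p) \<and> inj (frechet_derivative f (at p))"

definition singular_set :: "(real^2) set \<Rightarrow> (real^2 \<Rightarrow> real^3) \<Rightarrow> (real^2) set" where
  "singular_set U x = {p \<in> U. \<not> immersive_at x p}"

definition front_on :: "(real^2) set \<Rightarrow> (real^2 \<Rightarrow> real^3) \<Rightarrow> (real^2 \<Rightarrow> real^2^3) \<Rightarrow> bool" where
  "front_on U x \<Omega> \<longleftrightarrow> frontal_on U x \<and> (\<forall>p\<in>U. immersive_at (\<lambda>q. (x q, unit_normal \<Omega> q)) p)"

end

theory Submission
  imports Defs
begin

text \<open>Since $D\mathbf{x} = \Omega\Lambda^T$, $D\mathbf{n} = \Omega\mu^T$ and $\Omega$ is injective,
  $(\mathbf{x},\mathbf{n})$ fails to be immersive at a point exactly when $\Lambda^T$ and $\mu^T$ have a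
  common nonzero kernel vector. If this happens, every $s\mu + t\Lambda$ is singular, so the
  coefficients $K_\Omega$, $-2H_\Omega$ and $\det\Lambda$ of $\det(s\mu + t\Lambda)$ vanish. Conversely,
  a pencil of singular $2\times 2$ matrices has a common left or a common right kernel; the symmetry of
  $D\mathbf{x}^T D\mathbf{n} = \Lambda\mathbf{I}_\Omega\mu^T$ (equality of mixed partial derivatives) and
  the definiteness of $\mathbf{I}_\Omega$ yield a common left kernel in both cases.\<close>

section \<open>Symmetry of second derivatives\<close>

text \<open>The mean value theorem in the direction u turns the second difference into t times a
  difference of two values of \<open>g' _ u\<close>. Differentiability of \<open>g' _ u\<close> at p
  makes that difference \<open>t * L v\<close> up to o(t). The numerator is symmetric in u and v,
  which is the point of this form.\<close>

lemma second_difference_quotient_tendsto: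
  fixes g :: "'a::real_normed_vector \<Rightarrow> real"
  assumes S: "open S" "p \<in> S"
    and g: "\<And>q. q \<in> S \<Longrightarrow> (g has_derivative g' q) (at q)"
    and L: "((\<lambda>q. g' q u) has_derivative L) (at p)"
  shows "((\<lambda>t. (g (p + t *\<^sub>R u + t *\<^sub>R v) - g (p + t *\<^sub>R u) - g (p + t *\<^sub>R v) + g p) / t\<^sup>2)
           \<longlongrightarrow> L v) (at_right 0)"
proof (rule tendstoI)
  fix e :: real assume "e > 0"
  \<comment> \<open>Makes \<open>t * M\<close> a bound for
    \<open>s *\<^sub>R u + s' *\<^sub>R v\<close> when s and s' lie in [0, t]; the summand 1 keeps M
    positive when u = v = 0.\<close>
  define M where "M = norm u + norm v + 1"
  have "M > 0" by (simp add: M_def add_nonneg_pos)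
  \<comment> \<open>Two errors of size \<open>e' * (t * M)\<close> add up to t e / 2, which is e / 2
    < e after division by t.\<close>
  define e' where "e' = e / (4 * M)"
  have "e' > 0" using \<open>e > 0\<close> \<open>M > 0\<close> by (simp add: e'_def)
  have lin: "linear L" using L by (rule has_derivative_linear)
  obtain d where "d > 0" and
    d: "\<And>y. norm (y - p) < d \<Longrightarrow> norm (g' y u - g' p u - L (y - p)) \<le> e' * norm (y - p)"
    using L \<open>e' > 0\<close> unfolding has_derivative_at_alt by blast
  obtain r where "r > 0" and r: "ball p r \<subseteq> S"
    using S open_contains_ball by blast
  have "eventually (\<lambda>t. t \<in> {0<..<min d r / M}) (at_right 0)"
    using \<open>d > 0\<close> \<open>r > 0\<close> \<open>M > 0\<close> by (intro eventually_at_right_real) simp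
  then show "eventually (\<lambda>t. dist ((g (p + t *\<^sub>R u + t *\<^sub>R v) - g (p + t *\<^sub>R u)
      - g (p + t *\<^sub>R v) + g p) / t\<^sup>2) (L v) < e) (at_right 0)"
  proof eventually_elim
    case (elim t)
    have "t > 0" and tM: "t * M < d" "t * M < r" using elim \<open>M > 0\<close> by (auto simp: field_simps)
    have small: "norm (s *\<^sub>R u + s' *\<^sub>R v) \<le> t * M" if "0 \<le> s" "s \<le> t" "0 \<le> s'" "s' \<le> t" for s s'
    proof -
      have "norm (s *\<^sub>R u + s' *\<^sub>R v) \<le> s * norm u + s' * norm v"
        using norm_triangle_ineq[of "s *\<^sub>R u" "s' *\<^sub>R v"] that by simp
      also have "\<dots> \<le> t * norm u + t * norm v"
        using that by (intro add_mono mult_right_mono) auto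
      also have "\<dots> \<le> t * M" using \<open>t > 0\<close> by (simp add: M_def algebra_simps)
      finally show ?thesis .
    qed
    have inS: "p + s *\<^sub>R u + s' *\<^sub>R v \<in> S" if "0 \<le> s" "s \<le> t" "0 \<le> s'" "s' \<le> t" for s s'
    proof -
      have "dist p (p + z) = norm z" for z by (simp add: dist_norm)
      then have "dist p (p + (s *\<^sub>R u + s' *\<^sub>R v)) < r"
        using small[OF that] tM by simp
      then show ?thesis using r by (auto simp: add.assoc)
    qed
    have approx: "\<bar>g' (p + s *\<^sub>R u + s' *\<^sub>R v) u - g' p u - L (s *\<^sub>R u + s' *\<^sub>R v)\<bar> \<le> e' * (t * M)"
      if "0 \<le> s" "s \<le> t" "0 \<le> s'" "s' \<le> t" for s s'
    proof -
      have "norm (s *\<^sub>R u + s' *\<^sub>R v) < d" using small[OF that] tM by linarith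
      then have "\<bar>g' (p + s *\<^sub>R u + s' *\<^sub>R v) u - g' p u - L (s *\<^sub>R u + s' *\<^sub>R v)\<bar>
          \<le> e' * norm (s *\<^sub>R u + s' *\<^sub>R v)"
        using d[of "p + s *\<^sub>R u + s' *\<^sub>R v"] by (simp add: add.assoc)
      also have "\<dots> \<le> e' * (t * M)" using small[OF that] \<open>e' > 0\<close> by simp
      finally show ?thesis .
    qed
    \<comment> \<open>The mean value theorem for this difference gives one \<xi> that serves both
      parallel segments. The term \<open>0 *\<^sub>R v\<close> lets \<open>deriv\<close> and
      \<open>approx\<close> apply to both.\<close>
    define \<phi> where "\<phi> = (\<lambda>s. g (p + s *\<^sub>R u + t *\<^sub>R v) - g (p + s *\<^sub>R u + 0 *\<^sub>R v))"
    have deriv: "((\<lambda>s. g (p + s *\<^sub>R u + s' *\<^sub>R v)) has_derivative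
        (\<lambda>h. h * g' (p + s *\<^sub>R u + s' *\<^sub>R v) u)) (at s)"
      if "0 \<le> s" "s \<le> t" "0 \<le> s'" "s' \<le> t" for s s'
    proof -
      have "((\<lambda>s. p + s *\<^sub>R u + s' *\<^sub>R v) has_derivative (\<lambda>h. h *\<^sub>R u)) (at s)"
        by (auto intro!: derivative_eq_intros)
      from has_derivative_compose[OF this g[OF inS[OF that]]]
      show ?thesis
        using has_derivative_linear[OF g[OF inS[OF that]]] by (simp add: linear_cmul)
    qed
    obtain \<xi> where \<xi>: "0 < \<xi>" "\<xi> < t" and
      mvt: "\<phi> t - \<phi> 0 = (t - 0) * g' (p + \<xi> *\<^sub>R u + t *\<^sub>R v) u - (t - 0) * g' (p + \<xi> *\<^sub>R u + 0 *\<^sub>R v) u"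
    proof -
      have D: "(\<phi> has_derivative (\<lambda>h. h * g' (p + s *\<^sub>R u + t *\<^sub>R v) u
          - h * g' (p + s *\<^sub>R u + 0 *\<^sub>R v) u)) (at s within {0..t})" if "0 \<le> s" "s \<le> t" for s
        unfolding \<phi>_def using that \<open>t > 0\<close>
        by (intro has_derivative_at_withinI[OF has_derivative_diff[OF deriv deriv]]) simp_all
      show thesis
        using mvt_simple[OF \<open>t > 0\<close> D] that by auto
    qed
    define A B where "A = g' (p + \<xi> *\<^sub>R u + t *\<^sub>R v) u" and "B = g' (p + \<xi> *\<^sub>R u + 0 *\<^sub>R v) u"
    have "\<bar>A - g' p u - L (\<xi> *\<^sub>R u + t *\<^sub>R v)\<bar> \<le> e' * (t * M)"
      "\<bar>B - g' p u - L (\<xi> *\<^sub>R u + 0 *\<^sub>R v)\<bar> \<le> e' * (t * M)"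
      using approx[of \<xi> t] approx[of \<xi> 0] \<xi> \<open>t > 0\<close> by (auto simp: A_def B_def)
    \<comment> \<open>The common term \<open>\<xi> * L u\<close> cancels in A - B, leaving
      \<open>t * L v\<close>.\<close>
    moreover have "L (\<xi> *\<^sub>R u + t *\<^sub>R v) = \<xi> * L u + t * L v" "L (\<xi> *\<^sub>R u + 0 *\<^sub>R v) = \<xi> * L u"
      using lin by (simp_all add: linear_add linear_cmul)
    ultimately have "\<bar>(A - B) - t * L v\<bar> \<le> 2 * (e' * (t * M))" by linarith
    also have "\<dots> = t * e / 2" using \<open>M > 0\<close> by (simp add: e'_def)
    finally have est: "\<bar>(A - B) - t * L v\<bar> \<le> t * e / 2" .
    have "g (p + t *\<^sub>R u + t *\<^sub>R v) - g (p + t *\<^sub>R u) - g (p + t *\<^sub>R v) + g p = t * (A - B)"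
      using mvt by (simp add: \<phi>_def A_def B_def right_diff_distrib)
    then have "(g (p + t *\<^sub>R u + t *\<^sub>R v) - g (p + t *\<^sub>R u) - g (p + t *\<^sub>R v) + g p) / t\<^sup>2 - L v
        = t * (A - B) / t\<^sup>2 - L v"
      by (simp only:)
    also have "\<dots> = ((A - B) - t * L v) / t"
      using \<open>t > 0\<close> by (simp add: power2_eq_square field_simps)
    also have "\<bar>\<dots>\<bar> \<le> e / 2" using est \<open>t > 0\<close> by (simp add: abs_divide field_simps)
    finally show ?case using \<open>e > 0\<close> by (simp add: dist_real_def)
  qed
qed

text \<open>Exchanging u and v leaves the second difference unchanged, so its two limits agree.
  Pairing with a fixed vector m reduces to real values, where the mean value theorem is
  available.\<close>

lemma second_derivative_symmetric:
  fixes f :: "'a::real_normed_vector \<Rightarrow> 'b::real_inner"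
  assumes S: "open S" "p \<in> S"
    and f: "\<And>q. q \<in> S \<Longrightarrow> (f has_derivative f' q) (at q)"
    and u: "((\<lambda>q. f' q u) has_derivative F) (at p)"
    and v: "((\<lambda>q. f' q v) has_derivative G) (at p)"
  shows "F v = G u"
proof -
  have "F v \<bullet> m = G u \<bullet> m" for m
  proof -
    let ?g = "\<lambda>q. f q \<bullet> m"
    let ?Q = "\<lambda>u v t. (?g (p + t *\<^sub>R u + t *\<^sub>R v) - ?g (p + t *\<^sub>R u) - ?g (p + t *\<^sub>R v) + ?g p) / t\<^sup>2"
    have g: "\<And>q. q \<in> S \<Longrightarrow> (?g has_derivative (\<lambda>h. f' q h \<bullet> m)) (at q)"
      using f by (rule has_derivative_inner_left)
    have "(?Q u v \<longlongrightarrow> F v \<bullet> m) (at_right 0)"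
      by (rule second_difference_quotient_tendsto[OF S g]) (use u in \<open>auto intro: has_derivative_inner_left\<close>)
    moreover have "(?Q v u \<longlongrightarrow> G u \<bullet> m) (at_right 0)"
      by (rule second_difference_quotient_tendsto[OF S g]) (use v in \<open>auto intro: has_derivative_inner_left\<close>)
    moreover have "?Q v u = ?Q u v"
      by (simp add: fun_eq_iff algebra_simps)
    ultimately show ?thesis
      by (intro tendsto_unique[OF trivial_limit_at_right_real]) auto
  qed
  then show ?thesis by (metis vector_eq_rdot)
qed

section \<open>Pencils of singular matrices\<close>

lemma transpose_mult_vec_2:
  fixes A :: "real^2^2"
  shows "transpose A *v h = 0 \<longleftrightarrow>
    A$1$1 * h$1 + A$2$1 * h$2 = 0 \<and> A$1$2 * h$1 + A$2$2 * h$2 = 0"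
  by (simp add: vec_eq_iff forall_2 matrix_vector_mult_def transpose_def sum_2)

text \<open>A common left kernel vector exists iff the 2x4 matrix (L | M) has rank below 2, that is,
  iff its six 2x2 minors vanish. The determinants are two of them, the trace is the difference of
  two others, and \<open>sym\<close> is a linear relation weighted by the definite form J. It will
  be used with J the first fundamental form.\<close>

lemma common_left_kernel_iff:
  fixes L M J :: "real^2^2"
  assumes J: "transpose J = J" "det J > 0"
    and sym: "transpose (L ** J ** transpose M) = L ** J ** transpose M"
    and L: "det L = 0"
  shows "(\<exists>h. h \<noteq> 0 \<and> transpose L *v h = 0 \<and> transpose M *v h = 0) \<longleftrightarrow>
    det M = 0 \<and> trace (M ** adjugate2 L) = 0"
proof -
  obtain a b c d where l: "a = L$1$1" "b = L$1$2" "c = L$2$1" "d = L$2$2" by simp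
  obtain e f g h where m: "e = M$1$1" "f = M$1$2" "g = M$2$1" "h = M$2$2" by simp
  have "J$2$1 = J$1$2"
    using arg_cong[OF J(1), of "\<lambda>A. A$1$2"] by (simp add: transpose_def)
  then obtain E F G where i: "E = J$1$1" "F = J$1$2" "F = J$2$1" "G = J$2$2" by simp
  have tr: "trace (M ** adjugate2 L) = a * h + e * d - f * c - b * g"
    by (simp add: l m trace_def matrix_matrix_mult_def adjugate2_def sum_2)
  have ad: "a * d - b * c = 0" using L by (simp add: l det_2)
  have EG: "E * G - F * F > 0" using J(2) by (simp add: det_2 flip: i)
  have "(L ** J ** transpose M)$1$2 = (L ** J ** transpose M)$2$1"
    using arg_cong[OF sym, of "\<lambda>A. A$2$1"] by (simp add: transpose_def)
  \<comment> \<open>The difference of the two off-diagonal entries, grouped by the coefficients of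
    J.\<close>
  then have s: "E * (a * g - c * e) + F * (a * h - c * f + (b * g - d * e)) + G * (b * h - d * f) = 0"
    by (simp add: matrix_matrix_mult_def transpose_def sum_2 flip: l m i(1,4))
      (simp add: algebra_simps flip: i)
  show ?thesis
  proof
    assume "\<exists>h. h \<noteq> 0 \<and> transpose L *v h = 0 \<and> transpose M *v h = 0"
    then obtain k where "k \<noteq> 0" and
      k: "transpose L *v k = 0" "transpose M *v k = 0" by blast
    have k1: "a * k$1 + c * k$2 = 0" "b * k$1 + d * k$2 = 0"
       "e * k$1 + g * k$2 = 0" "f * k$1 + h * k$2 = 0"
      using k unfolding transpose_mult_vec_2 l m by blast+
    have "k$1 \<noteq> 0 \<or> k$2 \<noteq> 0" using \<open>k \<noteq> 0\<close> by (auto simp: vec_eq_iff forall_2)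
    \<comment> \<open>A coordinate of k times each expression is a combination of the relations
      \<open>k1\<close>; one coordinate is nonzero.\<close>
    moreover have "k$1 * (e * h - f * g) = 0" "k$2 * (e * h - f * g) = 0"
      "k$1 * (a * h + e * d - f * c - b * g) = 0" "k$2 * (a * h + e * d - f * c - b * g) = 0"
      using k1 by algebra+
    ultimately show "det M = 0 \<and> trace (M ** adjugate2 L) = 0"
      by (auto simp: tr det_2 simp flip: m)
  next
    assume *: "det M = 0 \<and> trace (M ** adjugate2 L) = 0"
    then have eh: "e * h - f * g = 0" by (simp add: det_2 m)
    \<comment> \<open>The minors of (L | M) that mix a column of L with a column of M. The fourth
      one is \<open>b * g - d * e\<close>, and vanishing of the trace says that it equals Q.\<close>
    define P Q S where "P = a * g - c * e" and "Q = a * h - c * f" and "S = b * h - d * f"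
    have Q': "b * g - d * e = Q" using conjunct2[OF *] unfolding tr Q_def by (simp add: algebra_simps)
    have lin: "E * P + 2 * F * Q + G * S = 0" using s Q' by (simp add: P_def Q_def S_def algebra_simps)
    \<comment> \<open>the Pluecker relation for the four columns\<close>
    have quad: "P * S = Q * Q" using ad eh Q' unfolding P_def Q_def S_def by algebra
    \<comment> \<open>Completing the square after multiplying \<open>lin\<close> by
      \<open>E * P\<close>: both terms on the left are nonnegative because J is definite, so Q =
      0.\<close>
    have "(E * P + F * Q)\<^sup>2 + (E * G - F * F) * Q\<^sup>2 = E * P * (E * P + 2 * F * Q + G * S)"
      using quad by algebra
    then have "(E * P + F * Q)\<^sup>2 + (E * G - F * F) * Q\<^sup>2 = 0" using lin by simp
    then have "(E * G - F * F) * Q\<^sup>2 \<le> 0"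
      using zero_le_power2[of "E * P + F * Q"] by linarith
    then have "Q = 0" using EG by (simp add: mult_le_0_iff)
    then have "P = 0 \<or> S = 0" "E * P + G * S = 0" using lin quad by auto
    moreover have "E \<noteq> 0" "G \<noteq> 0" using EG zero_le_square[of F] by auto
    ultimately have "P = 0" "S = 0" by auto
    with ad eh Q' \<open>Q = 0\<close> have rels: "a * d = b * c" "e * h = f * g" "a * g = c * e"
        "b * h = d * f" "a * h = c * f" "b * g = d * e"
      by (simp_all add: P_def Q_def S_def)
    have k: "\<exists>h. h \<noteq> 0 \<and> transpose L *v h = 0 \<and> transpose M *v h = 0"
      if "\<alpha> \<noteq> 0 \<or> \<beta> \<noteq> 0" "\<alpha> * a + \<beta> * c = 0" "\<alpha> * b + \<beta> * d = 0" "\<alpha> * e + \<beta> * g = 0"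
        "\<alpha> * f + \<beta> * h = 0" for \<alpha> \<beta>
    proof (intro exI conjI)
      let ?h = "vector [\<alpha>, \<beta>] :: real^2"
      show "?h \<noteq> 0" using that(1) by (auto simp: vec_eq_iff forall_2)
      show "transpose L *v ?h = 0" "transpose M *v ?h = 0"
        using that unfolding transpose_mult_vec_2 by (simp_all add: mult.commute flip: l m)
    qed
    \<comment> \<open>A nonzero column (y, z) of (L | M) yields the kernel vector (z, -y), since
      every minor containing that column vanishes. If all columns are zero, any nonzero vector
      works.\<close>
    consider "a \<noteq> 0 \<or> c \<noteq> 0" | "b \<noteq> 0 \<or> d \<noteq> 0" | "e \<noteq> 0 \<or> g \<noteq> 0" | "f \<noteq> 0 \<or> h \<noteq> 0"
      | "a = 0" "b = 0" "c = 0" "d = 0" "e = 0" "f = 0" "g = 0" "h = 0" by blast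
    then show "\<exists>h. h \<noteq> 0 \<and> transpose L *v h = 0 \<and> transpose M *v h = 0"
    proof cases
      case 1 then show ?thesis by (intro k[of c "- a"]) (use rels in \<open>auto simp: mult.commute\<close>)
    next
      case 2 then show ?thesis by (intro k[of d "- b"]) (use rels in \<open>auto simp: mult.commute\<close>)
    next
      case 3 then show ?thesis by (intro k[of g "- e"]) (use rels in \<open>auto simp: mult.commute\<close>)
    next
      case 4 then show ?thesis by (intro k[of h "- f"]) (use rels in \<open>auto simp: mult.commute\<close>)
    next
      case 5 then show ?thesis by (intro k[of 1 0]) auto
    qed
  qed
qed

section \<open>Tangent moving bases\<close>

lemma cross3_column_nonzero:
  assumes "column 1 W \<noteq> column 2 W" "independent {column 1 W, column 2 W}"
  shows "cross3 (column 1 W) (column 2 (W :: real^2^3)) \<noteq> 0"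
proof
  assume "cross3 (column 1 W) (column 2 W) = 0"
  then have "collinear {0, column 1 W, column 2 W}" by (simp add: cross_eq_0)
  then consider "column 1 W = 0" | "column 2 W = 0" | c where "column 2 W = c *\<^sub>R column 1 W"
    by (auto simp: collinear_lemma)
  then show False
  proof cases
    case 3
    \<comment> \<open>The columns differ, so column 1 survives the removal of column 2 from the
      set.\<close>
    then have "column 2 W \<in> span ({column 1 W, column 2 W} - {column 2 W})"
      using assms(1) by (auto simp: insert_Diff_if intro: span_base span_scale)
    then show False using assms(2) unfolding dependent_def by blast
  qed (use assms dependent_zero in \<open>metis insertI1 insertI2\<close>)+
qed

text \<open>By the expansion of the double cross product, y is parallel to
  \<open>cross3 v w\<close>, but it is also orthogonal to that nonzero vector.\<close>

lemma cross3_eq_0_imp_eq_0: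
  assumes "cross3 v w \<bullet> y = 0" "v \<bullet> y = 0" "w \<bullet> y = 0" "cross3 v w \<noteq> 0"
  shows "y = 0"
proof -
  have "cross3 y (cross3 v w) = (y \<bullet> w) *\<^sub>R v - (y \<bullet> v) *\<^sub>R w"
    by (simp add: cross3_simps forall_3)
  then have "cross3 y (cross3 v w) = 0"
    using assms by (simp add: inner_commute)
  then show ?thesis
    using norm_and_cross_eq_0[of y "cross3 v w"] assms by (auto simp: inner_commute)
qed

text \<open>Lagrange's identity for the cross product.\<close>

lemma det_gram:
  fixes W :: "real^2^3"
  shows "det (transpose W ** W) = (norm (cross3 (column 1 W) (column 2 W)))\<^sup>2"
  unfolding power2_norm_eq_inner
  by (simp add: det_2 matrix_matrix_mult_def transpose_def column_def cross3_simps sum_3 forall_3)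

lemma matrix_inv_inverse:
  assumes "invertible A"
  shows "A ** matrix_inv A = mat 1" "matrix_inv A ** A = mat 1"
  using someI_ex[OF assms[unfolded invertible_def]] by (auto simp: matrix_inv_def)

lemma matrix_inv_symmetric:
  fixes A :: "real^'n^'n"
  assumes "invertible A" "transpose A = A"
  shows "transpose (matrix_inv A) = matrix_inv A"
proof -
  have "transpose (matrix_inv A) ** A = mat 1"
    using arg_cong[OF matrix_inv_inverse(1)[OF assms(1)], of transpose] assms(2)
    by (simp add: matrix_transpose_mul)
  then show ?thesis
    by (metis assms(1) matrix_inv_inverse(1) matrix_mul_assoc matrix_mul_lid matrix_mul_rid)
qed

lemma matrix_mul_uminus:
  fixes A :: "real^'n^'m" and B :: "real^'k^'n"
  shows "(- A) ** B = - (A ** B)" "A ** (- B) = - (A ** B)"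
  by (simp_all add: matrix_matrix_mult_def vec_eq_iff sum_negf)

lemma matrix_diff_ldistrib:
  fixes A :: "real^'n^'m" and B C :: "real^'k^'n"
  shows "A ** (B - C) = A ** B - A ** C"
  by (simp add: matrix_matrix_mult_def vec_eq_iff right_diff_distrib sum_subtractf)

lemma transpose_uminus: "transpose (- A) = - transpose (A :: real^'n^'m)"
  by (simp add: transpose_def vec_eq_iff)

text \<open>The right side is the orthogonal projection of A onto the column space of W. The
  residual is orthogonal to both columns and, by the second assumption, to their cross product, so
  it vanishes. This gives the factorizations of both Jacobians.\<close>

lemma tangent_factorization:
  fixes W A :: "real^2^3"
  assumes c: "cross3 (column 1 W) (column 2 W) \<noteq> 0"
    and A: "\<And>h. cross3 (column 1 W) (column 2 W) \<bullet> (A *v h) = 0"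
  shows "A = W ** (matrix_inv (transpose W ** W) ** transpose W ** A)"
proof -
  let ?I = "transpose W ** W"
  have "invertible ?I" using c by (simp add: invertible_det_nz det_gram)
  then have inv: "?I ** matrix_inv ?I = mat 1"
    by (rule matrix_inv_inverse)
  let ?B = "W ** (matrix_inv ?I ** transpose W ** A)"
  have "transpose W ** ?B = (?I ** matrix_inv ?I) ** transpose W ** A"
    by (simp only: matrix_mul_assoc)
  then have 1: "transpose W ** (A - ?B) = 0"
    by (simp add: inv matrix_diff_ldistrib)
  have col: "column i W \<bullet> z = (transpose W *v z) $ i" for i and z :: "real^3"
    by (simp add: column_def matrix_vector_mult_def transpose_def inner_vec_def)
  have "(A - ?B) *v h = 0" for h
  proof (rule cross3_eq_0_imp_eq_0)
    have W: "cross3 (column 1 W) (column 2 W) \<bullet> (W *v k) = 0" for k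
      by (simp add: matrix_mult_sum sum_2 inner_add_right scalar_mult_eq_scaleR dot_cross_self)
    show "cross3 (column 1 W) (column 2 W) \<bullet> ((A - ?B) *v h) = 0"
      using A W by (simp add: matrix_vector_mult_diff_rdistrib inner_diff_right
        flip: matrix_vector_mul_assoc)
    show "column 1 W \<bullet> ((A - ?B) *v h) = 0" "column 2 W \<bullet> ((A - ?B) *v h) = 0"
      using 1 by (simp_all add: col matrix_vector_mul_assoc)
  qed (use c in auto)
  then have "A - ?B = 0" by (simp add: matrix_eq)
  then show ?thesis by simp
qed

lemma smooth_on_imp_differentiable:
  "smooth_on S f \<Longrightarrow> p \<in> S \<Longrightarrow> f differentiable (at p)"
  unfolding smooth_on_def by (drule spec[of _ "Suc 0"]) simp

lemma smooth_on_imp_derivative_differentiable: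
  assumes "smooth_on S f" "p \<in> S"
  shows "(\<lambda>q. frechet_derivative f (at q) v) differentiable (at p)"
proof -
  have "Ck_on (Suc (Suc 0)) S f" using assms(1) unfolding smooth_on_def by blast
  then show ?thesis using assms(2) by (simp only: Ck_on.simps)
qed

text \<open>\<open>transpose A ** B\<close> is the matrix of the bilinear form sending (h, k) to
  \<open>(A *v h) \<bullet> (B *v k)\<close>.\<close>

lemma transpose_mult_symmetric:
  fixes A B :: "real^'n^'m"
  assumes "\<And>h k. (A *v h) \<bullet> (B *v k) = (A *v k) \<bullet> (B *v h)"
  shows "transpose (transpose A ** B) = transpose A ** B"
proof -
  have "h \<bullet> ((transpose B ** A) *v k) = h \<bullet> ((transpose A ** B) *v k)" for h k
  proof -
    have "h \<bullet> ((transpose C ** D) *v k) = (C *v h) \<bullet> (D *v k)" for C D :: "real^'n^'m"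
      using dot_lmul_matrix[of h "transpose C" "D *v k"] by (simp flip: matrix_vector_mul_assoc)
    then show ?thesis using assms[of h k] by (simp only: inner_commute)
  qed
  then have "(transpose B ** A) *v k = (transpose A ** B) *v k" for k
    using vector_eq_ldot[of "(transpose B ** A) *v k" "(transpose A ** B) *v k"] by blast
  then show ?thesis
    by (simp add: matrix_transpose_mul matrix_eq)
qed

lemma det_nonzero_iff_kernel:
  fixes A :: "real^'n^'n"
  shows "det A \<noteq> 0 \<longleftrightarrow> (\<forall>h. A *v h = 0 \<longrightarrow> h = 0)"
  using det_nz_iff_inj[of "(*v) A"] linear_injective_0[of "(*v) A"] by simp

section \<open>The unit normal field of a tangent moving base\<close>

locale tangent_base =
  fixes U :: "(real^2) set" and x :: "real^2 \<Rightarrow> real^3" and \<Omega> :: "real^2 \<Rightarrow> real^2^3"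
  assumes open_U: "open U" and smooth_x: "smooth_on U x" and base: "tangent_moving_base U x \<Omega>"
begin

abbreviation "n \<equiv> unit_normal \<Omega>"
text \<open>The unnormalised normal; orthogonality is stated for it because
  \<open>tangent_factorization\<close> takes it in this form.\<close>

abbreviation "w p \<equiv> cross3 (column 1 (\<Omega> p)) (column 2 (\<Omega> p))"

lemma w_nonzero: "p \<in> U \<Longrightarrow> w p \<noteq> 0"
  using base cross3_column_nonzero by (auto simp: tangent_moving_base_def Let_def)

lemma norm_n: "p \<in> U \<Longrightarrow> norm (n p) = 1"
  using w_nonzero by (simp add: unit_normal_def)

lemma x_derivative: "p \<in> U \<Longrightarrow> (x has_derivative (*v) (jacobian x (at p))) (at p)"
  using smooth_on_imp_differentiable[OF smooth_x] by (simp add: jacobian_works)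

text \<open>The cross product is bilinear, and the norm is differentiable away from 0, where w
  stays.\<close>

lemma n_derivative:
  assumes "p \<in> U"
  shows "(n has_derivative (*v) (jacobian n (at p))) (at p)"
proof -
  obtain D where D: "(\<Omega> has_derivative D) (at p)"
    using smooth_on_imp_differentiable base assms
    unfolding tangent_moving_base_def differentiable_def by blast
  have "linear (column i :: real^2^3 \<Rightarrow> real^3)" for i
    by (rule linearI) (simp_all add: column_def vec_eq_iff)
  then have "(\<lambda>q. column i (\<Omega> q)) differentiable (at p)" for i
    using bounded_linear.has_derivative[OF _ D] linear_conv_bounded_linear differentiable_def
    by metis
  moreover have "bounded_bilinear cross3"
    using bilinear_cross bilinear_conv_bounded_bilinear by blast
  ultimately have w: "w differentiable (at p)"
    unfolding differentiable_def using bounded_bilinear.FDERIV by blast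
  have "n differentiable (at p)"
    unfolding unit_normal_def[abs_def] using w w_nonzero[OF assms]
    by (intro differentiable_scaleR differentiable_inverse
        differentiable_chain_at[of w p norm, unfolded o_def]) auto
  then show ?thesis by (simp add: jacobian_works)
qed

lemma n_orthogonal_dx:
  assumes "p \<in> U"
  shows "w p \<bullet> (jacobian x (at p) *v h) = 0"
proof -
  have "w p \<bullet> y = 0" if "y \<in> span {column 1 (\<Omega> p), column 2 (\<Omega> p)}" for y
    by (rule orthogonal_to_span[OF that, of "w p", unfolded orthogonal_def]) (auto simp: dot_cross_self)
  then show ?thesis
    using base assms
    by (auto simp: tangent_moving_base_def Let_def matrix_mult_sum sum_2 inner_add_right scalar_mult_eq_scaleR)
qed

text \<open>Differentiate the identity \<open>n q \<bullet> n q = 1\<close>, valid on the open set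
  U.\<close>

lemma n_orthogonal_dn:
  assumes "p \<in> U"
  shows "w p \<bullet> (jacobian n (at p) *v h) = 0"
proof -
  have "((\<lambda>q. n q \<bullet> n q) has_derivative
      (\<lambda>h. n p \<bullet> (jacobian n (at p) *v h) + (jacobian n (at p) *v h) \<bullet> n p)) (at p)"
    by (intro has_derivative_inner n_derivative assms)
  moreover have "((\<lambda>q. n q \<bullet> n q) has_derivative (\<lambda>h. 0)) (at p)"
    by (rule has_derivative_transform_within_open[OF has_derivative_const[of 1] open_U assms])
      (simp add: norm_n dot_square_norm)
  ultimately have "(\<lambda>h. n p \<bullet> (jacobian n (at p) *v h) + (jacobian n (at p) *v h) \<bullet> n p) = (\<lambda>h. 0)"
    by (rule has_derivative_unique)
  from fun_cong[OF this, of h] have "n p \<bullet> (jacobian n (at p) *v h) = 0" by (simp add: inner_commute)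
  then show ?thesis using w_nonzero[OF assms] by (simp add: unit_normal_def)
qed

text \<open>Differentiating the orthogonality of n and the tangent vectors of x expresses each side
  as minus the normal component of a second derivative of x, and second derivatives are
  symmetric.\<close>

lemma dx_dn_symmetric:
  assumes "p \<in> U"
  shows "(jacobian x (at p) *v u) \<bullet> (jacobian n (at p) *v v) =
    (jacobian x (at p) *v v) \<bullet> (jacobian n (at p) *v u)"
proof -
  have "\<exists>D. ((\<lambda>q. jacobian x (at q) *v k) has_derivative D) (at p)" for k
  proof -
    obtain D where "((\<lambda>q. frechet_derivative x (at q) k) has_derivative D) (at p)"
      using smooth_on_imp_derivative_differentiable[OF smooth_x assms] differentiable_def by blast
    then have "((\<lambda>q. jacobian x (at q) *v k) has_derivative D) (at p)"
      by (rule has_derivative_transform_within_open[OF _ open_U assms])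
        (simp add: frechet_derivative_at[OF x_derivative, symmetric])
    then show ?thesis by blast
  qed
  \<comment> \<open>\<open>F u v\<close> is the second derivative of x at p in the directions u and
    v.\<close>
  then obtain F where F: "\<And>k. ((\<lambda>q. jacobian x (at q) *v k) has_derivative F k) (at p)"
    using choice[of "\<lambda>k D. ((\<lambda>q. jacobian x (at q) *v k) has_derivative D) (at p)"] by blast
  have sym: "F u v = F v u"
    using second_derivative_symmetric[OF open_U assms x_derivative F F] .
  have weingarten: "n p \<bullet> F u v = - ((jacobian x (at p) *v u) \<bullet> (jacobian n (at p) *v v))" for u v
  proof -
    have "((\<lambda>q. n q \<bullet> (jacobian x (at q) *v u)) has_derivative
        (\<lambda>h. n p \<bullet> F u h + (jacobian n (at p) *v h) \<bullet> (jacobian x (at p) *v u))) (at p)"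
      by (intro has_derivative_inner n_derivative assms F)
    moreover have "((\<lambda>q. n q \<bullet> (jacobian x (at q) *v u)) has_derivative (\<lambda>h. 0)) (at p)"
      by (rule has_derivative_transform_within_open[OF has_derivative_const[of 0] open_U assms])
        (simp add: unit_normal_def n_orthogonal_dx)
    ultimately have "(\<lambda>h. n p \<bullet> F u h + (jacobian n (at p) *v h) \<bullet> (jacobian x (at p) *v u)) = (\<lambda>h. 0)"
      by (rule has_derivative_unique)
    from fun_cong[OF this, of v] show ?thesis by (simp add: inner_commute)
  qed
  show ?thesis using weingarten[of u v] weingarten[of v u] sym by simp
qed

section \<open>The first fundamental form and the matrices \<Lambda> and \<mu>\<close>

lemma fund_I_symmetric: "transpose (fund_I \<Omega> p) = fund_I \<Omega> p"
  by (simp add: fund_I_def matrix_transpose_mul)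

lemma det_fund_I_pos: "p \<in> U \<Longrightarrow> det (fund_I \<Omega> p) > 0"
  using w_nonzero by (simp add: fund_I_def det_gram)

lemma transpose_inv_fund_I:
  assumes "p \<in> U"
  shows "transpose (matrix_inv (fund_I \<Omega> p)) = matrix_inv (fund_I \<Omega> p)"
proof -
  have "invertible (fund_I \<Omega> p)"
    using det_fund_I_pos[OF assms] by (simp add: invertible_det_nz)
  then show ?thesis
    using fund_I_symmetric by (rule matrix_inv_symmetric)
qed

lemma dx_factorization:
  assumes "p \<in> U"
  shows "jacobian x (at p) = \<Omega> p ** transpose (Lambda_mat x \<Omega> p)"
proof -
  have "transpose (Lambda_mat x \<Omega> p) = matrix_inv (fund_I \<Omega> p) ** transpose (\<Omega> p) ** jacobian x (at p)"
    by (simp add: Lambda_mat_def matrix_transpose_mul transpose_inv_fund_I[OF assms] matrix_mul_assoc)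
  then show ?thesis
    using tangent_factorization[OF w_nonzero n_orthogonal_dx] assms by (simp add: fund_I_def)
qed

text \<open>The minus signs in \<open>mu_mat\<close> and \<open>fund_II\<close> cancel, so the
  transpose of \<mu> is the coefficient matrix of the projection.\<close>

lemma dn_factorization:
  assumes "p \<in> U"
  shows "jacobian n (at p) = \<Omega> p ** transpose (mu_mat \<Omega> p)"
proof -
  have "transpose (mu_mat \<Omega> p) = matrix_inv (fund_I \<Omega> p) ** transpose (\<Omega> p) ** jacobian n (at p)"
    by (simp add: mu_mat_def fund_II_def matrix_transpose_mul transpose_uminus matrix_mul_uminus
        transpose_inv_fund_I[OF assms] matrix_mul_assoc)
  then show ?thesis
    using tangent_factorization[OF w_nonzero n_orthogonal_dn] assms by (simp add: fund_I_def)
qed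

lemma base_injective:
  assumes "p \<in> U"
  shows "\<Omega> p *v k = 0 \<longleftrightarrow> k = 0"
proof
  assume "\<Omega> p *v k = 0"
  then have "fund_I \<Omega> p *v k = 0"
    by (simp add: fund_I_def flip: matrix_vector_mul_assoc)
  then show "k = 0"
    using det_fund_I_pos[OF assms] det_nonzero_iff_kernel[of "fund_I \<Omega> p"] by auto
qed simp

text \<open>By the two factorizations B is the product of the transposed Jacobian of x with the
  Jacobian of n. This provides the hypothesis \<open>sym\<close> of
  \<open>common_left_kernel_iff\<close>.\<close>

lemma Lambda_I_mu_symmetric:
  assumes "p \<in> U"
  defines "B \<equiv> Lambda_mat x \<Omega> p ** fund_I \<Omega> p ** transpose (mu_mat \<Omega> p)"
  shows "transpose B = B"
proof -
  have "B = transpose (jacobian x (at p)) ** jacobian n (at p)"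
    unfolding B_def fund_I_def dx_factorization[OF assms(1)] dn_factorization[OF assms(1)]
    by (simp add: matrix_transpose_mul matrix_mul_assoc)
  then show ?thesis
    using transpose_mult_symmetric[OF dx_dn_symmetric[OF assms(1)]] by simp
qed

section \<open>Immersivity in terms of \<Lambda> and \<mu>\<close>

lemma immersive_x_iff:
  assumes "p \<in> U"
  shows "immersive_at x p \<longleftrightarrow> det (Lambda_mat x \<Omega> p) \<noteq> 0"
proof -
  have "immersive_at x p \<longleftrightarrow> inj ((*v) (jacobian x (at p)))"
    using frechet_derivative_at[OF x_derivative[OF assms]] differentiableI[OF x_derivative[OF assms]]
    by (simp add: immersive_at_def)
  also have "\<dots> \<longleftrightarrow> (\<forall>h. transpose (Lambda_mat x \<Omega> p) *v h = 0 \<longrightarrow> h = 0)"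
    by (simp add: linear_injective_0 dx_factorization assms base_injective
        flip: matrix_vector_mul_assoc)
  also have "\<dots> \<longleftrightarrow> det (transpose (Lambda_mat x \<Omega> p)) \<noteq> 0"
    by (rule det_nonzero_iff_kernel[symmetric])
  finally show ?thesis by simp
qed

text \<open>The kernel of the derivative of the pair is the intersection of the two kernels, and the
  injective factor \<open>\<Omega> p\<close> cancels from each.\<close>

lemma immersive_pair_iff:
  assumes "p \<in> U"
  shows "immersive_at (\<lambda>q. (x q, n q)) p \<longleftrightarrow>
    \<not> (\<exists>h. h \<noteq> 0 \<and> transpose (Lambda_mat x \<Omega> p) *v h = 0 \<and> transpose (mu_mat \<Omega> p) *v h = 0)"
proof -
  let ?D = "\<lambda>h. (jacobian x (at p) *v h, jacobian n (at p) *v h)"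
  have D: "((\<lambda>q. (x q, n q)) has_derivative ?D) (at p)"
    by (intro has_derivative_Pair x_derivative n_derivative assms)
  have "immersive_at (\<lambda>q. (x q, n q)) p \<longleftrightarrow> inj ?D"
    using frechet_derivative_at[OF D] differentiableI[OF D] by (simp add: immersive_at_def)
  also have "\<dots> \<longleftrightarrow> (\<forall>h. ?D h = 0 \<longrightarrow> h = 0)"
    using has_derivative_linear[OF D] by (rule linear_injective_0)
  finally show ?thesis
    by (auto simp: zero_prod_def dx_factorization dn_factorization assms base_injective
        simp flip: matrix_vector_mul_assoc)
qed

text \<open>At a singular point det \<Lambda> = 0, so \<open>common_left_kernel_iff\<close> applies
  to \<Lambda>, \<mu> and the first fundamental form; the factor -1/2 does not affect
  vanishing.\<close>

lemma immersive_pair_iff_curvature: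
  assumes "p \<in> singular_set U x"
  shows "immersive_at (\<lambda>q. (x q, n q)) p \<longleftrightarrow>
    (relative_curvature \<Omega> p, relative_mean_curvature x \<Omega> p) \<noteq> (0, 0)"
proof -
  have p: "p \<in> U" "det (Lambda_mat x \<Omega> p) = 0"
    using assms immersive_x_iff by (auto simp: singular_set_def)
  show ?thesis
    using common_left_kernel_iff[OF fund_I_symmetric det_fund_I_pos Lambda_I_mu_symmetric] p
    by (simp add: immersive_pair_iff relative_curvature_def relative_mean_curvature_def)
qed

text \<open>Here the transpose of \<Lambda> alone has trivial kernel, so the front condition only
  has to be tested on the singular set.\<close>

lemma immersive_pair_if_regular:
  assumes "p \<in> U" "p \<notin> singular_set U x"
  shows "immersive_at (\<lambda>q. (x q, n q)) p"
proof -
  have "det (transpose (Lambda_mat x \<Omega> p)) \<noteq> 0"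
    using assms immersive_x_iff by (auto simp: singular_set_def)
  then show ?thesis
    unfolding immersive_pair_iff[OF assms(1)] det_nonzero_iff_kernel by blast
qed

end

theorem corollary3p23:
  fixes U :: "(real^2) set"
    and x :: "real^2 \<Rightarrow> real^3"
    and \<Omega> :: "real^2 \<Rightarrow> real^2^3"
  assumes "open U"
    and "frontal_on U x"
    and "tangent_moving_base U x \<Omega>"
  shows "front_on U x \<Omega> \<longleftrightarrow>
    (\<forall>p\<in>singular_set U x. (relative_curvature \<Omega> p, relative_mean_curvature x \<Omega> p) \<noteq> (0, 0))"
proof -
  interpret tangent_base U x \<Omega>
    using assms by unfold_locales (simp_all add: frontal_on_def)
  have "front_on U x \<Omega> \<longleftrightarrow> (\<forall>p\<in>U. immersive_at (\<lambda>q. (x q, n q)) p)"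
    using assms(2) by (simp add: front_on_def)
  also have "\<dots> \<longleftrightarrow> (\<forall>p\<in>singular_set U x. immersive_at (\<lambda>q. (x q, n q)) p)"
    using immersive_pair_if_regular by (auto simp: singular_set_def)
  finally show ?thesis using immersive_pair_iff_curvature by simp
qed

end
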